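(* Let $\alpha\in\mathbb{R}$, $\alpha\neq 0,1$, and put $b=\frac12+\epsilon$, $b'=-\frac12+2\epsilon$. (a) The trilinear estimate $$\|(vw_1w_2)_x\|_{X_{s,b'}}\lesssim \|v\|_{X_{s,b}}\|w_1\|_{X^\alpha_{k,b}}\|w_2\|_{X^\alpha_{k,b}}$$ fails to hold whenever $s-k>2$, for any $\epsilon$ such that $0<\epsilon<\frac23(s-k-2)$. (b) The trilinear estimate $$\|(v_1v_2w)_x\|_{X^\alpha_{k,b'}}\lesssim \|v_1\|_{X_{s,b}}\|v_2\|_{X_{s,b}}\|w\|_{X^\alpha_{k,b}}$$ fails to hold whenever $k-s>2$, for any $\epsilon$ such that $0<\epsilon<\frac23(k-s-2)$.
   Context: Write $\langle\cdot\rangle:=1+|\cdot|$ and let $\tilde f(\tau,\xi)$ denote the space-time Fourier transform of $f(t,x)$. For $s,b\in\mathbb{R}$, $X^{\alpha}_{s,b}$ is the completion of the Schwartz class $\mathcal{S}(\mathbb{R}^2)$ under the norm $$\|f\|_{X^{\alpha}_{s,b}}:=\|\langle\xi\rangle^s\langle\tau-\alpha\xi^3\rangle^b\tilde f(\tau,\xi)\|_{L^2_{\tau,\xi}},$$ and $X_{s,b}:=X^1_{s,b}$. The subscript $x$ denotes $\partial_x$. An estimate $A\lesssim B$ "holds" if there is a constant $C>0$, independent of the functions involved, such that $A\le CB$ for all (Schwartz) functions; it "fails to hold" if no such constant exists. *)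

theory Defs
  imports "HOL-Analysis.Analysis"
begin

text \<open>
  Space-time functions have type \<open>real \<times> real \<Rightarrow> complex\<close>. Points in physical space are \<open>(t, x)\<close>,
  points in frequency space are \<open>(\<tau>, \<xi>)\<close>.
\<close>

definition dt :: "(real \<times> real \<Rightarrow> complex) \<Rightarrow> real \<times> real \<Rightarrow> complex" where
  "dt f = (\<lambda>(t, x). vector_derivative (\<lambda>r. f (r, x)) (at t))"

definition dx :: "(real \<times> real \<Rightarrow> complex) \<Rightarrow> real \<times> real \<Rightarrow> complex" where
  "dx f = (\<lambda>(t, x). vector_derivative (\<lambda>r. f (t, r)) (at x))"

text \<open>
  The first conjunct says that \<open>f\<close> is smooth: if all \<open>\<partial>\<^sub>t\<^sup>m \<partial>\<^sub>x\<^sup>n f\<close> are (Frechet) differentiable, then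
  they are continuous and, by symmetry of second derivatives, they are all the partial derivatives
  of \<open>f\<close>.
\<close>

definition schwartz :: "(real \<times> real \<Rightarrow> complex) \<Rightarrow> bool" where
  "schwartz f \<longleftrightarrow>
     (\<forall>m n z. (dt ^^ m) ((dx ^^ n) f) differentiable (at z)) \<and>
     (\<forall>i j m n. bounded (range (\<lambda>(t, x). (t ^ i * x ^ j) *\<^sub>R (dt ^^ m) ((dx ^^ n) f) (t, x))))"

text \<open>
  The normalisation is the one under which \<open>\<partial>\<^sub>x\<close> becomes multiplication by \<open>\<i> \<xi>\<close>, so that
  solutions of \<open>u\<^sub>t + \<alpha> u\<^sub>x\<^sub>x\<^sub>x = 0\<close> live on the curve \<open>\<tau> = \<alpha> \<xi>\<^sup>3\<close>.
  A constant prefactor would not affect whether the estimates hold.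
\<close>

definition fourier :: "(real \<times> real \<Rightarrow> complex) \<Rightarrow> real \<times> real \<Rightarrow> complex" where
  "fourier f = (\<lambda>(\<tau>, \<xi>). LINT (t, x)|lborel. exp (- \<i> * complex_of_real (t * \<tau> + x * \<xi>)) * f (t, x))"

definition bracket :: "real \<Rightarrow> real" where
  "bracket r = 1 + \<bar>r\<bar>"

definition L2_norm :: "(real \<times> real \<Rightarrow> complex) \<Rightarrow> real" where
  "L2_norm g = sqrt (LINT p|lborel. (cmod (g p))\<^sup>2)"

text \<open>
  This is the norm of \<open>X\<^sup>\<alpha>\<^sub>s\<^sub>,\<^sub>b\<close> on Schwartz functions, where the integral below is always finite; it is
  not meaningful for functions whose weighted transform is not square integrable.
\<close>

definition X_norm :: "real \<Rightarrow> real \<Rightarrow> real \<Rightarrow> (real \<times> real \<Rightarrow> complex) \<Rightarrow> real" where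
  "X_norm \<alpha> s b f =
     L2_norm (\<lambda>(\<tau>, \<xi>). (bracket \<xi> powr s * bracket (\<tau> - \<alpha> * \<xi> ^ 3) powr b) *\<^sub>R fourier f (\<tau>, \<xi>))"

end

theory Submission
  imports Defs "HOL-Probability.Characteristic_Functions" "HOL-Real_Asymp.Real_Asymp"
begin

text \<open>
  Both estimates put the factor carrying the output dispersion \<open>\<beta>\<close> next to two factors carrying the
  other dispersion \<open>\<gamma>\<close>; (a) is \<open>(\<beta>, \<gamma>) = (1, \<alpha>)\<close> and (b) is \<open>(\<beta>, \<gamma>) = (\<alpha>, 1)\<close> with \<open>s\<close> and \<open>k\<close>
  exchanged. They fail because a single factor of dispersion \<open>\<gamma>\<close> can put a high frequency \<open>N\<close> into
  the output at the price of only \<open>k\<close> derivatives, whereas the output norm charges \<open>s + 1\<close> of them.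
  The other two factors may stay at frequency zero.

  Concretely, let \<open>G = exp (- (t\<^sup>2 + x\<^sup>2) / 2)\<close>, and take \<open>G\<close> for the factor of dispersion
  \<open>\<beta>\<close> and for one factor of dispersion \<open>\<gamma>\<close>. The third factor is \<open>G\<close> modulated to the space-time
  frequency \<open>(\<gamma> N\<^sup>3, N)\<close>, a point of its own curve \<open>\<tau> = \<gamma> \<xi>\<^sup>3\<close>. Its Fourier transform is a Gaussian of
  unit width about that point, and within unit distance \<open>\<tau> - \<gamma> \<xi>\<^sup>3\<close> grows to order \<open>N\<^sup>2\<close>, so its norm
  is \<open>O(N\<^sup>k\<^sup>+\<^sup>2\<^sup>b)\<close> (\<open>X_norm_packet_on_curve_le\<close>). The norms of the two copies of \<open>G\<close> are independent of
  \<open>N\<close>. The product of the three is a Gaussian wave packet at the same frequency, which lies at height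
  \<open>(\<gamma> - \<beta>) N\<^sup>3\<close> over the output curve \<open>\<tau> = \<beta> \<xi>\<^sup>3\<close>; as \<open>\<gamma> \<noteq> \<beta>\<close>, the norm of its \<open>x\<close>-derivative is at least of
  order \<open>N\<close> to the power \<open>s + 1 + 3 b'\<close> (\<open>X_norm_dx_packet_off_curve_ge\<close>). With \<open>b = 1/2 + \<epsilon>\<close> and
  \<open>b' = - 1/2 + 2 \<epsilon>\<close> the output exponent exceeds the input exponent by
  \<open>s - k - 3/2 + 4 \<epsilon> > 0\<close>, and letting \<open>N\<close> tend to infinity contradicts any constant
  (\<open>trilinear_estimate_fails\<close>).

  All transforms are explicit since the packets are products of one-dimensional Gaussian waves, whose
  integrals follow from the characteristic function of the normal distribution.
\<close>

section \<open>One-dimensional Gaussian waves\<close>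

text \<open>
  The Gaussian \<open>exp (- c x\<^sup>2 / 2)\<close> carried by the plane wave \<open>exp (\<i> B x)\<close>. With \<open>c = 0\<close> it is the bare plane
  wave, so that multiplication by the Fourier kernel is an instance of \<open>wave_mult\<close>. It is written
  as an entire function at a real argument, which makes the complex rules for derivatives
  apply.
\<close>

definition wave :: "real \<Rightarrow> real \<Rightarrow> real \<Rightarrow> complex" where
  "wave c B x = exp (of_real (- c / 2) * (of_real x)\<^sup>2 + \<i> * of_real B * of_real x)"

lemma norm_wave: "cmod (wave c B x) = exp (- (c / 2) * x\<^sup>2)"
  by (simp add: wave_def power2_eq_square)

lemma wave_mult: "wave c B x * wave c' B' x = wave (c + c') (B + B') x"
  unfolding wave_def exp_add[symmetric] by (rule arg_cong[where f = exp]) (simp add: field_simps)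

text \<open>
  Differentiation acts on the polynomial factor alone; iterating it shows that every derivative of a
  Gaussian wave is a polynomial times the same wave.
\<close>

lemma has_vector_derivative_poly_wave:
  "((\<lambda>x. poly p (of_real x) * wave c B x) has_vector_derivative
     poly (pderiv p + [:\<i> * of_real B, - of_real c:] * p) (of_real x) * wave c B x) (at x)"
  unfolding wave_def
  by (rule has_vector_derivative_real_field)
     (auto intro!: derivative_eq_intros poly_DERIV simp: algebra_simps)

lemma has_vector_derivative_wave:
  "(wave c B has_vector_derivative (\<i> * of_real B - of_real c * of_real x) * wave c B x) (at x)"
  using has_vector_derivative_poly_wave[of 1 c B x] by (simp add: algebra_simps)

lemma continuous_wave: "continuous_on UNIV (wave c B)"
  unfolding wave_def by (intro continuous_intros)

lemma bracket_ge_1: "1 \<le> bracket r"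
  by (simp add: bracket_def)

lemma bracket_pos [simp]: "0 < bracket r"
  by (simp add: bracket_def add_pos_nonneg)

lemma bracket_neq_0 [simp]: "bracket r \<noteq> 0"
  using bracket_pos[of r] by linarith

lemma bracket_nonneg [simp]: "0 \<le> bracket r"
  by (simp add: bracket_def)

text \<open>
  Half of the Gaussian decay absorbs any power weight: \<open>\<langle>x\<rangle>\<^sup>p \<le> exp (\<bar>p\<bar> \<bar>x\<bar>)\<close>, and
  \<open>\<bar>p\<bar> \<bar>x\<bar> \<le> p\<^sup>2 / (2 c) + c x\<^sup>2 / 2\<close> by the inequality of arithmetic and geometric means.
\<close>

lemma bracket_powr_gaussian_le:
  assumes "c > 0"
  shows "bracket x powr p * exp (- c * x\<^sup>2) \<le> exp (p\<^sup>2 / (2 * c)) * exp (- (c / 2) * x\<^sup>2)"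
proof -
  have "p * ln (bracket x) \<le> \<bar>p\<bar> * ln (bracket x)"
    by (intro mult_right_mono) (auto simp: bracket_def)
  also have "\<dots> \<le> \<bar>p\<bar> * \<bar>x\<bar>"
    unfolding bracket_def by (intro mult_left_mono ln_add_one_self_le_self) auto
  also have "\<dots> \<le> p\<^sup>2 / (2 * c) + c / 2 * x\<^sup>2"
  proof -
    have "0 \<le> (c * \<bar>x\<bar> - \<bar>p\<bar>)\<^sup>2" by simp
    also have "\<dots> = c\<^sup>2 * x\<^sup>2 + p\<^sup>2 - 2 * c * (\<bar>p\<bar> * \<bar>x\<bar>)"
      by (simp add: power2_diff power_mult_distrib)
    finally show ?thesis using assms by (simp add: field_simps power2_eq_square)
  qed
  finally have "p * ln (bracket x) + (- c * x\<^sup>2) \<le> p\<^sup>2 / (2 * c) + (- (c / 2) * x\<^sup>2)"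
    by simp
  then have "exp (p * ln (bracket x) + (- c * x\<^sup>2)) \<le> exp (p\<^sup>2 / (2 * c) + (- (c / 2) * x\<^sup>2))"
    by simp
  then show ?thesis unfolding exp_add by (simp add: powr_def)
qed

lemma norm_poly_le_bracket:
  "\<exists>K n. K \<ge> 0 \<and> (\<forall>x. cmod (poly p (of_real x)) \<le> K * bracket x ^ n)"
proof (induction p)
  case 0
  show ?case by (auto intro!: exI[of _ 0])
next
  case (pCons a p)
  then obtain K n where K: "K \<ge> 0" "\<And>x. cmod (poly p (of_real x)) \<le> K * bracket x ^ n" by auto
  have "cmod (poly (pCons a p) (of_real x)) \<le> (cmod a + K) * bracket x ^ Suc n" for x
  proof -
    have "cmod (poly (pCons a p) (of_real x)) \<le> cmod a + \<bar>x\<bar> * cmod (poly p (of_real x))"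
      by (auto intro!: order.trans[OF norm_triangle_ineq] simp: norm_mult)
    also have "\<dots> \<le> cmod a * bracket x ^ Suc n + bracket x * (K * bracket x ^ n)"
      using K one_le_power[OF bracket_ge_1, of x "Suc n"]
      by (intro add_mono mult_mono) (auto simp: bracket_def mult_left_le mult_le_cancel_left1)
    finally show ?thesis by (simp add: algebra_simps)
  qed
  then show ?case using K(1) by (intro exI[of _ "cmod a + K"] exI[of _ "Suc n"]) auto
qed

lemma norm_poly_wave_le:
  assumes "c > 0"
  obtains K where "K \<ge> 0" "\<And>x. cmod (poly p (of_real x) * wave c B x) \<le> K * exp (- (c / 4) * x\<^sup>2)"
proof -
  obtain K n where K: "K \<ge> 0" "\<And>x. cmod (poly p (of_real x)) \<le> K * bracket x ^ n"
    using norm_poly_le_bracket by blast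
  have "cmod (poly p (of_real x) * wave c B x) \<le> K * exp ((real n)\<^sup>2 / c) * exp (- (c / 4) * x\<^sup>2)" for x
  proof -
    have "cmod (poly p (of_real x) * wave c B x) \<le> K * bracket x ^ n * exp (- (c / 2) * x\<^sup>2)"
      using K(2) by (auto simp: norm_mult norm_wave intro!: mult_right_mono)
    also have "\<dots> = K * (bracket x powr real n * exp (- (c / 2) * x\<^sup>2))"
      by (simp add: powr_realpow)
    also have "\<dots> \<le> K * (exp ((real n)\<^sup>2 / (2 * (c / 2))) * exp (- (c / 2 / 2) * x\<^sup>2))"
      using assms K(1) by (intro mult_left_mono bracket_powr_gaussian_le) auto
    finally show ?thesis by (simp add: mult.assoc)
  qed
  then show ?thesis using K(1) that[of "K * exp ((real n)\<^sup>2 / c)"] by simp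
qed

lemma integrable_gaussian:
  assumes "c > 0"
  shows "integrable lborel (\<lambda>x::real. exp (- c * x\<^sup>2))"
proof -
  have "integrable lborel (\<lambda>x. sqrt (pi / c) * normal_density 0 (1 / sqrt (2 * c)) x)"
    using assms by (intro integrable_mult_right integrable_normal_density) simp
  also have "(\<lambda>x. sqrt (pi / c) * normal_density 0 (1 / sqrt (2 * c)) x) = (\<lambda>x. exp (- c * x\<^sup>2))"
  proof
    fix x :: real
    have \<sigma>: "(1 / sqrt (2 * c))\<^sup>2 = 1 / (2 * c)"
      using assms by (simp add: power_divide)
    have "sqrt (pi / c) > 0" using assms by simp
    then show "sqrt (pi / c) * normal_density 0 (1 / sqrt (2 * c)) x = exp (- c * x\<^sup>2)"
      using assms unfolding normal_density_def \<sigma> by simp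
  qed
  finally show ?thesis .
qed

lemma integrable_poly_wave:
  assumes "c > 0"
  shows "integrable lborel (\<lambda>x. poly p (of_real x) * wave c B x)"
proof -
  obtain K where K: "\<And>x. cmod (poly p (of_real x) * wave c B x) \<le> K * exp (- (c / 4) * x\<^sup>2)"
    using norm_poly_wave_le assms by blast
  show ?thesis
  proof (rule Bochner_Integration.integrable_bound)
    show "integrable lborel (\<lambda>x. K * exp (- (c / 4) * x\<^sup>2))"
      using assms by (intro integrable_mult_right integrable_gaussian) auto
    have "continuous_on UNIV (\<lambda>x. poly p (complex_of_real x) * wave c B x)"
      by (intro continuous_intros continuous_wave)
    then show "(\<lambda>x. poly p (complex_of_real x) * wave c B x) \<in> borel_measurable lborel"
      by (simp add: borel_measurable_continuous_onI)
    show "AE x in lborel. cmod (poly p (of_real x) * wave c B x) \<le> norm (K * exp (- (c / 4) * x\<^sup>2))"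
      using order.trans[OF K abs_ge_self] by auto
  qed
qed

lemma integrable_wave: "c > 0 \<Longrightarrow> integrable lborel (wave c B)"
  using integrable_poly_wave[of c 1 B] by simp

text \<open>
  For \<open>c = 1\<close> this is the characteristic function of the standard normal distribution; the general case
  is the substitution \<open>x \<mapsto> x / \<surd>c\<close>.
\<close>

lemma integral_wave:
  assumes "c > 0"
  shows "(LINT x|lborel. wave c B x) = of_real (sqrt (2 * pi / c) * exp (- B\<^sup>2 / (2 * c)))"
proof -
  have std: "(LINT x|lborel. wave 1 t x) = of_real (sqrt (2 * pi) * exp (- t\<^sup>2 / 2))" for t
  proof -
    have "of_real (exp (- t\<^sup>2 / 2)) = (LINT x|lborel. std_normal_density x *\<^sub>R iexp (t * x))"
      using char_std_normal_distribution[THEN fun_cong, of t]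
      by (simp add: char_def integral_density)
    also have "\<dots> = (LINT x|lborel. of_real (1 / sqrt (2 * pi)) * wave 1 t x)"
      by (intro Bochner_Integration.integral_cong refl)
         (simp add: std_normal_density_def wave_def scaleR_conv_of_real exp_of_real[symmetric]
            mult_ac exp_add[symmetric])
    also have "\<dots> = of_real (1 / sqrt (2 * pi)) * (LINT x|lborel. wave 1 t x)"
      by (rule integral_mult_right_zero)
    finally show ?thesis by (simp add: field_simps)
  qed
  have "(LINT x|lborel. wave c B x) = \<bar>1 / sqrt c\<bar> *\<^sub>R (LINT x|lborel. wave c B (0 + 1 / sqrt c * x))"
    using assms by (intro lborel_integral_real_affine) auto
  also have "(\<lambda>x. wave c B (0 + 1 / sqrt c * x)) = wave 1 (B / sqrt c)"
    using assms by (auto simp: wave_def fun_eq_iff power_divide simp flip: of_real_power)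
  also have "\<bar>1 / sqrt c\<bar> *\<^sub>R (LINT x|lborel. wave 1 (B / sqrt c) x)
      = of_real (sqrt (2 * pi / c) * exp (- B\<^sup>2 / (2 * c)))"
    using assms by (simp add: std scaleR_conv_of_real real_sqrt_divide power_divide field_simps)
  finally show ?thesis .
qed

lemma wave_tendsto_0:
  assumes "c > 0" and "F \<le> at_infinity"
  shows "(wave c B \<longlongrightarrow> 0) F"
proof -
  have "filterlim (\<lambda>x. \<bar>x\<bar>\<^sup>2) at_top F"
    using filterlim_mono[OF filterlim_norm_at_top order_refl assms(2)]
    by (intro filterlim_pow_at_top) (auto simp: real_norm_def[abs_def])
  then have "filterlim (\<lambda>x. (c / 2) * \<bar>x\<bar>\<^sup>2) at_top F"
    using assms(1) by (intro filterlim_tendsto_pos_mult_at_top[OF tendsto_const]) auto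
  then have "filterlim (\<lambda>x. - ((c / 2) * \<bar>x\<bar>\<^sup>2)) at_bot F"
    by (simp add: filterlim_uminus_at_bot)
  then have "((\<lambda>x. exp (- ((c / 2) * \<bar>x\<bar>\<^sup>2))) \<longlongrightarrow> 0) F"
    by (rule filterlim_compose[OF exp_at_bot])
  then have "((\<lambda>x. cmod (wave c B x)) \<longlongrightarrow> 0) F"
    by (simp add: norm_wave)
  then show ?thesis by (rule tendsto_norm_zero_cancel)
qed

text \<open>
  The integrand is the derivative of a function that vanishes at both ends of the line. This is the
  integration by parts behind \<open>fourier_dx_packet\<close>.
\<close>

lemma integral_deriv_wave:
  assumes "c > 0"
  shows "(LINT x|lborel. (\<i> * of_real B - of_real c * of_real x) * wave c B x) = 0"
proof -
  have int: "integrable lborel (\<lambda>x. (\<i> * of_real B - of_real c * of_real x) * wave c B x)"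
    using integrable_poly_wave[OF assms, of "[:\<i> * of_real B, - of_real c:]" B] by (simp add: algebra_simps)
  have "(LBINT x=-\<infinity>..\<infinity>. (\<i> * of_real B - of_real c * of_real x) * wave c B x) = 0 - 0"
  proof (rule interval_integral_FTC_integrable)
    fix x
    show "(wave c B has_vector_derivative (\<i> * of_real B - of_real c * of_real x) * wave c B x) (at x)"
      by (rule has_vector_derivative_wave)
    show "isCont (\<lambda>x. (\<i> * of_real B - of_real c * of_real x) * wave c B x) x"
      unfolding wave_def by (intro continuous_intros)
  next
    show "set_integrable lborel (einterval (- \<infinity>) \<infinity>)
       (\<lambda>x. (\<i> * of_real B - of_real c * of_real x) * wave c B x)"
      using int by (simp add: set_integrable_def)
    show "((wave c B \<circ> real_of_ereal) \<longlongrightarrow> 0) (at_right (- \<infinity>))"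
      unfolding ereal_tendsto_simps using assms by (intro wave_tendsto_0 at_bot_le_at_infinity)
    show "((wave c B \<circ> real_of_ereal) \<longlongrightarrow> 0) (at_left \<infinity>)"
      unfolding ereal_tendsto_simps using assms
      by (intro wave_tendsto_0 at_top_le_at_infinity)
  qed auto
  then show ?thesis by (simp add: interval_lebesgue_integral_def set_lebesgue_integral_def)
qed


section \<open>Wave packets and their Fourier transforms\<close>

lemma dx_tensor:
  assumes "\<And>x. (v has_vector_derivative v' x) (at x)"
  shows "dx (\<lambda>(t, x). u t * v x) = (\<lambda>(t, x). u t * v' x)"
  unfolding dx_def
  by (auto simp: fun_eq_iff intro!: vector_derivative_at has_vector_derivative_mult_right assms)

lemma dt_tensor:
  assumes "\<And>t. (u has_vector_derivative u' t) (at t)"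
  shows "dt (\<lambda>(t, x). u t * v x) = (\<lambda>(t, x). u' t * v x)"
  unfolding dt_def
  by (auto simp: fun_eq_iff intro!: vector_derivative_at has_vector_derivative_mult_left assms)

definition packet :: "real \<Rightarrow> real \<Rightarrow> real \<Rightarrow> real \<times> real \<Rightarrow> complex" where
  "packet c A B = (\<lambda>(t, x). wave c A t * wave c B x)"

lemma packet_mult: "packet c A B z * packet c' A' B' z = packet (c + c') (A + A') (B + B') z"
  by (cases z) (simp add: packet_def wave_mult[symmetric] mult_ac)

lemma bounded_poly_wave:
  assumes "c > 0"
  shows "bounded (range (\<lambda>x. poly p (of_real x) * wave c B x))"
proof -
  obtain K where K: "K \<ge> 0" "\<And>x. cmod (poly p (of_real x) * wave c B x) \<le> K * exp (- (c / 4) * x\<^sup>2)"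
    using norm_poly_wave_le assms by blast
  have "cmod (poly p (of_real x) * wave c B x) \<le> K" for x
  proof -
    have "K * exp (- (c / 4) * x\<^sup>2) \<le> K * 1"
      using assms K(1) by (intro mult_left_mono) auto
    then show ?thesis using K(2)[of x] by simp
  qed
  then show ?thesis by (auto simp: bounded_iff)
qed

text \<open>
  Functions \<open>p(t) q(x)\<close> times the packet, with \<open>p\<close> and \<open>q\<close> polynomials, are closed under both partial
  derivatives and under multiplication by powers of \<open>t\<close> and \<open>x\<close>, and they are all bounded.
\<close>

lemma schwartz_packet:
  assumes "c > 0"
  shows "schwartz (packet c A B)"
proof -
  define form where "form p q = (\<lambda>(t, x). (poly p (of_real t) * wave c A t) * (poly q (of_real x) * wave c B x))"
    for p q
  define D where "D F p = pderiv p + [:\<i> * of_real F, - of_real c:] * p" for F :: real and p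
  have "dt (form p q) = form (D A p) q" for p q
    unfolding form_def D_def by (intro dt_tensor has_vector_derivative_poly_wave)
  then have dt: "(dt ^^ m) (form p q) = form ((D A ^^ m) p) q" for m p q
    by (induction m) auto
  have "dx (form p q) = form p (D B q)" for p q
    unfolding form_def D_def by (intro dx_tensor has_vector_derivative_poly_wave)
  then have dx: "(dx ^^ n) (form p q) = form p ((D B ^^ n) q)" for n p q
    by (induction n) auto
  have packet: "packet c A B = form 1 1"
    by (simp add: packet_def form_def)
  have derivs: "(dt ^^ m) ((dx ^^ n) (packet c A B)) = form ((D A ^^ m) 1) ((D B ^^ n) 1)" for m n
    by (simp add: packet dt dx)
  have diff: "form p q differentiable at z" for p q z
  proof -
    have 1: "(\<lambda>x. poly p (of_real x) * wave c F x) differentiable at x" for p F x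
      using has_vector_derivative_poly_wave differentiableI_vector by blast
    have "(\<lambda>z. (poly p (of_real (fst z)) * wave c A (fst z)) * (poly q (of_real (snd z)) * wave c B (snd z)))
        differentiable at z"
      by (intro differentiable_mult differentiable_compose[OF 1]
          bounded_linear_imp_differentiable bounded_linear_fst bounded_linear_snd)
    then show ?thesis unfolding form_def case_prod_beta' .
  qed
  have bdd: "bounded (range (\<lambda>(t, x). (t ^ i * x ^ j) *\<^sub>R form p q (t, x)))" for i j p q
  proof -
    obtain K where K: "\<And>t. cmod (poly (monom 1 i * p) (of_real t) * wave c A t) \<le> K"
      using bounded_poly_wave[OF assms, of "monom 1 i * p" A] by (auto simp: bounded_iff)
    obtain L where L: "\<And>x. cmod (poly (monom 1 j * q) (of_real x) * wave c B x) \<le> L"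
      using bounded_poly_wave[OF assms, of "monom 1 j * q" B] by (auto simp: bounded_iff)
    have "cmod ((t ^ i * x ^ j) *\<^sub>R form p q (t, x)) \<le> K * L" for t x
    proof -
      have "(t ^ i * x ^ j) *\<^sub>R form p q (t, x)
          = (poly (monom 1 i * p) (of_real t) * wave c A t) * (poly (monom 1 j * q) (of_real x) * wave c B x)"
        by (simp add: form_def scaleR_conv_of_real poly_monom mult_ac)
      then show ?thesis
        using mult_mono'[OF K L norm_ge_zero norm_ge_zero] by (simp only: norm_mult)
    qed
    then show ?thesis by (auto simp: bounded_iff)
  qed
  show ?thesis
    unfolding schwartz_def derivs using diff bdd by blast
qed

lemma
  fixes u v :: "real \<Rightarrow> 'a::{real_normed_field, banach, second_countable_topology}"
  assumes u: "integrable lborel u" and v: "integrable lborel v"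
  shows integrable_tensor: "integrable lborel (\<lambda>(t, x). u t * v x)"
    and integral_tensor: "(LINT (t, x)|lborel. u t * v x) = (LINT t|lborel. u t) * (LINT x|lborel. v x)"
proof -
  note [measurable] = borel_measurable_integrable[OF u] borel_measurable_integrable[OF v]
  have int: "integrable (lborel \<Otimes>\<^sub>M lborel) (\<lambda>(t, x). u t * v x)"
    using u v by (intro lborel_pair.Fubini_integrable) (auto simp: norm_mult)
  then show "integrable lborel (\<lambda>(t, x). u t * v x)"
    by (simp add: lborel_prod)
  show "(LINT (t, x)|lborel. u t * v x) = (LINT t|lborel. u t) * (LINT x|lborel. v x)"
    using lborel_pair.integral_fst'[OF int] by (simp add: lborel_prod)
qed

lemma fourier_tensor:
  assumes "integrable lborel u" "integrable lborel v"
  shows "fourier (\<lambda>(t, x). u t * v x) (\<tau>, \<xi>)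
      = (LINT t|lborel. wave 0 (- \<tau>) t * u t) * (LINT x|lborel. wave 0 (- \<xi>) x * v x)"
proof -
  have int: "integrable lborel (\<lambda>x. wave 0 B x * f x)" if "integrable lborel f" for f B
  proof (rule Bochner_Integration.integrable_bound[OF that])
    have [measurable]: "wave 0 B \<in> borel_measurable lborel"
      using continuous_wave by (simp add: borel_measurable_continuous_onI)
    note [measurable] = borel_measurable_integrable[OF that]
    show "(\<lambda>x. wave 0 B x * f x) \<in> borel_measurable lborel" by measurable
  qed (simp add: norm_mult norm_wave)
  have "fourier (\<lambda>(t, x). u t * v x) (\<tau>, \<xi>)
      = (LINT (t, x)|lborel. (wave 0 (- \<tau>) t * u t) * (wave 0 (- \<xi>) x * v x))"
    unfolding fourier_def split wave_def
    by (intro Bochner_Integration.integral_cong refl)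
       (auto simp: exp_add[symmetric] algebra_simps)
  also have "\<dots> = (LINT t|lborel. wave 0 (- \<tau>) t * u t) * (LINT x|lborel. wave 0 (- \<xi>) x * v x)"
    by (intro integral_tensor int assms)
  finally show ?thesis .
qed

lemma fourier_packet:
  assumes "c > 0"
  shows "fourier (packet c A B) (\<tau>, \<xi>)
    = of_real (2 * pi / c * exp (- (1 / (2 * c)) * ((\<tau> - A)\<^sup>2 + (\<xi> - B)\<^sup>2)))"
proof -
  have sq: "complex_of_real (sqrt (2 * pi / c)) * of_real (sqrt (2 * pi / c)) = of_real (2 * pi / c)"
    using assms by (simp flip: of_real_mult)
  have "fourier (packet c A B) (\<tau>, \<xi>)
      = of_real (sqrt (2 * pi / c) * exp (- (A - \<tau>)\<^sup>2 / (2 * c)))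
        * of_real (sqrt (2 * pi / c) * exp (- (B - \<xi>)\<^sup>2 / (2 * c)))"
    unfolding packet_def fourier_tensor[OF integrable_wave[OF assms] integrable_wave[OF assms]]
    using assms by (simp add: wave_mult integral_wave)
  also have "\<dots> = of_real (2 * pi / c * (exp (- (A - \<tau>)\<^sup>2 / (2 * c)) * exp (- (B - \<xi>)\<^sup>2 / (2 * c))))"
    unfolding of_real_mult sq[symmetric] by (simp only: mult_ac)
  also have "exp (- (A - \<tau>)\<^sup>2 / (2 * c)) * exp (- (B - \<xi>)\<^sup>2 / (2 * c))
      = exp (- (1 / (2 * c)) * ((\<tau> - A)\<^sup>2 + (\<xi> - B)\<^sup>2))"
    using assms by (simp add: exp_add[symmetric] field_simps power2_commute)
  finally show ?thesis .
qed

text \<open>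
  After the Fourier kernel has shifted the wave from \<open>B\<close> to \<open>B - \<xi>\<close>, the factor \<open>\<i> B - c x\<close> produced by
  the derivative splits into \<open>\<i> (B - \<xi>) - c x\<close>, which integrates to zero, and \<open>\<i> \<xi>\<close>.
\<close>

lemma fourier_dx_packet:
  assumes "c > 0"
  shows "fourier (dx (packet c A B)) (\<tau>, \<xi>) = \<i> * of_real \<xi> * fourier (packet c A B) (\<tau>, \<xi>)"
proof -
  have intd: "integrable lborel (\<lambda>x. (\<i> * of_real B - of_real c * of_real x) * wave c B x)" for B
    using integrable_poly_wave[OF assms, of "[:\<i> * of_real B, - of_real c:]" B] by (simp add: algebra_simps)
  have dx: "dx (packet c A B) = (\<lambda>(t, x). wave c A t * ((\<i> * of_real B - of_real c * of_real x) * wave c B x))"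
    unfolding packet_def by (intro dx_tensor has_vector_derivative_wave)
  have "(LINT x|lborel. wave 0 (- \<xi>) x * ((\<i> * of_real B - of_real c * of_real x) * wave c B x))
      = (LINT x|lborel. (\<i> * of_real (B - \<xi>) - of_real c * of_real x) * wave c (B - \<xi>) x
          + \<i> * of_real \<xi> * wave c (B - \<xi>) x)"
    by (intro Bochner_Integration.integral_cong refl)
       (simp add: wave_mult[of 0 "- \<xi>" _ c B, simplified, symmetric] algebra_simps)
  also have "\<dots> = 0 + \<i> * of_real \<xi> * (LINT x|lborel. wave c (B - \<xi>) x)"
    unfolding Bochner_Integration.integral_add[OF intd integrable_mult_right[OF integrable_wave[OF assms]]]
    by (simp only: integral_deriv_wave[OF assms] integral_mult_right_zero)
  also have "(LINT x|lborel. wave c (B - \<xi>) x) = (LINT x|lborel. wave 0 (- \<xi>) x * wave c B x)"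
    by (simp add: wave_mult)
  finally have *: "(LINT x|lborel. wave 0 (- \<xi>) x * ((\<i> * of_real B - of_real c * of_real x) * wave c B x))
      = \<i> * of_real \<xi> * (LINT x|lborel. wave 0 (- \<xi>) x * wave c B x)"
    by simp
  show ?thesis
    unfolding dx fourier_tensor[OF integrable_wave[OF assms] intd] *
    unfolding packet_def fourier_tensor[OF integrable_wave[OF assms] integrable_wave[OF assms]]
    by simp
qed

lemma
  fixes c A B :: real
  assumes "c > 0"
  shows integrable_gaussian_plane:
      "integrable lborel (\<lambda>(\<tau>, \<xi>). exp (- c * ((\<tau> - A)\<^sup>2 + (\<xi> - B)\<^sup>2)))"
    and integral_gaussian_plane:
      "(LINT (\<tau>, \<xi>)|lborel. exp (- c * ((\<tau> - A)\<^sup>2 + (\<xi> - B)\<^sup>2))) = (LINT x|lborel. exp (- c * x\<^sup>2))\<^sup>2"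
proof -
  have int: "integrable lborel (\<lambda>x. exp (- c * (x - F)\<^sup>2))" for F
    using lborel_integrable_real_affine[OF integrable_gaussian[OF assms], of 1 "- F"] by simp
  have eq: "(LINT x|lborel. exp (- c * (x - F)\<^sup>2)) = (LINT x|lborel. exp (- c * x\<^sup>2))" for F
    using lborel_integral_real_affine[of 1 "\<lambda>x. exp (- c * x\<^sup>2)" "- F"] by simp
  have split: "(\<lambda>(\<tau>, \<xi>). exp (- c * ((\<tau> - A)\<^sup>2 + (\<xi> - B)\<^sup>2)))
      = (\<lambda>(\<tau>, \<xi>). exp (- c * (\<tau> - A)\<^sup>2) * exp (- c * (\<xi> - B)\<^sup>2))"
    by (simp add: fun_eq_iff exp_add[symmetric] algebra_simps)
  show "integrable lborel (\<lambda>(\<tau>, \<xi>). exp (- c * ((\<tau> - A)\<^sup>2 + (\<xi> - B)\<^sup>2)))"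
    unfolding split by (rule integrable_tensor[OF int int])
  show "(LINT (\<tau>, \<xi>)|lborel. exp (- c * ((\<tau> - A)\<^sup>2 + (\<xi> - B)\<^sup>2))) = (LINT x|lborel. exp (- c * x\<^sup>2))\<^sup>2"
    unfolding split integral_tensor[OF int int] eq by (simp only: power2_eq_square)
qed


section \<open>Weights\<close>

lemma bracket_add_le: "bracket (x + y) \<le> bracket x * bracket y"
proof -
  have "\<bar>x + y\<bar> \<le> \<bar>x\<bar> + \<bar>y\<bar> + \<bar>x\<bar> * \<bar>y\<bar>"
    using abs_triangle_ineq[of x y] by (simp add: add_increasing2)
  then show ?thesis by (simp add: bracket_def algebra_simps)
qed

lemma bracket_mult_le: "bracket (x * y) \<le> bracket x * bracket y"
  by (simp add: bracket_def algebra_simps abs_mult)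

lemma bracket_minus [simp]: "bracket (- x) = bracket x"
  by (simp add: bracket_def)

text \<open>
  Peetre's inequality. For negative \<open>p\<close> it comes from \<open>\<langle>x\<rangle> \<le> \<langle>x + y\<rangle> \<langle>y\<rangle>\<close>.
\<close>

lemma peetre: "bracket (x + y) powr p \<le> bracket x powr p * bracket y powr \<bar>p\<bar>"
proof (cases "p \<ge> 0")
  case True
  then have "bracket (x + y) powr p \<le> (bracket x * bracket y) powr p"
    by (intro powr_mono2 bracket_add_le) auto
  then show ?thesis using True by (simp add: powr_mult)
next
  case False
  have "bracket x \<le> bracket (x + y) * bracket y"
    using bracket_add_le[of "x + y" "- y"] by simp
  then have "bracket x / bracket y \<le> bracket (x + y)"
    by (simp add: pos_divide_le_eq)
  then have "bracket (x + y) powr p \<le> (bracket x / bracket y) powr p"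
    using False by (intro powr_mono2') auto
  then show ?thesis using False by (simp add: powr_divide powr_minus field_simps)
qed

text \<open>
  Leaving the point \<open>(A, B)\<close> by \<open>(\<sigma>, \<eta>)\<close> changes \<open>\<tau> - \<beta> \<xi>\<^sup>3\<close> by \<open>\<sigma> - \<beta> (3 B\<^sup>2 \<eta> + 3 B \<eta>\<^sup>2 + \<eta>\<^sup>3)\<close>, which costs
  only two powers of \<open>\<langle>B\<rangle>\<close>, although \<open>\<xi>\<^sup>3\<close> itself has size \<open>\<langle>B\<rangle>\<^sup>3\<close>.
\<close>

lemma bracket_modulation_le:
  "bracket ((A + \<sigma>) - \<beta> * (B + \<eta>) ^ 3)
     \<le> bracket (A - \<beta> * B ^ 3) * (bracket \<sigma> * (bracket \<beta> * ((bracket B)\<^sup>2 * bracket \<eta> ^ 3)))"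
proof -
  let ?m = "3 * B\<^sup>2 * \<eta> + 3 * B * \<eta>\<^sup>2 + \<eta> ^ 3"
  have "\<bar>?m\<bar> \<le> 3 * \<bar>B\<bar>\<^sup>2 * \<bar>\<eta>\<bar> + 3 * \<bar>B\<bar> * \<bar>\<eta>\<bar>\<^sup>2 + \<bar>\<eta>\<bar> ^ 3"
    by (intro order.trans[OF abs_triangle_ineq] add_mono) (auto simp: abs_mult power_abs)
  also have "1 + \<dots> \<le> (bracket B)\<^sup>2 * bracket \<eta> ^ 3"
  proof -
    have "1 + (3 * u\<^sup>2 * h + 3 * u * h\<^sup>2 + h ^ 3) \<le> (1 + u)\<^sup>2 * (1 + h) ^ 3" if "u \<ge> 0" "h \<ge> 0" for u h :: real
      using that by (simp add: power2_eq_square power3_eq_cube algebra_simps)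
    from this[of "\<bar>B\<bar>" "\<bar>\<eta>\<bar>"] show ?thesis unfolding bracket_def by simp
  qed
  finally have m: "bracket ?m \<le> (bracket B)\<^sup>2 * bracket \<eta> ^ 3"
    by (simp add: bracket_def)
  have "(A + \<sigma>) - \<beta> * (B + \<eta>) ^ 3 = (A - \<beta> * B ^ 3) + (\<sigma> + - (\<beta> * ?m))"
    by (simp add: power2_eq_square power3_eq_cube algebra_simps)
  also have "bracket \<dots> \<le> bracket (A - \<beta> * B ^ 3) * bracket (\<sigma> + - (\<beta> * ?m))"
    by (rule bracket_add_le)
  also have "\<dots> \<le> bracket (A - \<beta> * B ^ 3) * (bracket \<sigma> * bracket (\<beta> * ?m))"
    using bracket_add_le[of \<sigma> "- (\<beta> * ?m)"] by (intro mult_left_mono) auto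
  also have "\<dots> \<le> bracket (A - \<beta> * B ^ 3) * (bracket \<sigma> * (bracket \<beta> * ((bracket B)\<^sup>2 * bracket \<eta> ^ 3)))"
    by (intro mult_left_mono order.trans[OF bracket_mult_le] m) auto
  finally show ?thesis .
qed

text \<open>
  Against a Gaussian centred at \<open>(A, B)\<close>, the weight of the \<open>X\<^sup>\<beta>\<^sub>s\<^sub>,\<^sub>p\<close> norm may be evaluated at the centre,
  up to the growth \<open>\<langle>B\<rangle>\<^sup>2\<close> of the modulation and with \<open>\<bar>p\<bar>\<close> in place of \<open>p\<close>. What matters is that \<open>K\<close> depends on neither \<open>A\<close> nor \<open>B\<close>.
\<close>

lemma weight_gaussian_le:
  assumes "c > 0"
  obtains K where "K \<ge> 0" and "\<And>A B \<tau> \<xi>.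
    bracket \<xi> powr s * bracket (\<tau> - \<beta> * \<xi> ^ 3) powr p * exp (- c * ((\<tau> - A)\<^sup>2 + (\<xi> - B)\<^sup>2))
      \<le> K * (bracket B powr s * (bracket (A - \<beta> * B ^ 3) * (bracket B)\<^sup>2) powr \<bar>p\<bar>)
          * exp (- (c / 2) * ((\<tau> - A)\<^sup>2 + (\<xi> - B)\<^sup>2))"
proof
  define q where "q = \<bar>s\<bar> + 3 * \<bar>p\<bar>"
  define K where "K = bracket \<beta> powr \<bar>p\<bar> * (exp (\<bar>p\<bar>\<^sup>2 / (2 * c)) * exp (q\<^sup>2 / (2 * c)))"
  show "K \<ge> 0" by (simp add: K_def)
  fix A B \<tau> \<xi> :: real
  define \<sigma> where "\<sigma> = \<tau> - A"
  define \<eta> where "\<eta> = \<xi> - B"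
  define W where "W = bracket B powr s * (bracket (A - \<beta> * B ^ 3) * (bracket B)\<^sup>2) powr \<bar>p\<bar>"
  have W: "W \<ge> 0" by (simp add: W_def)
  have s: "bracket \<xi> powr s \<le> bracket B powr s * bracket \<eta> powr \<bar>s\<bar>"
    using peetre[of B \<eta> s] by (simp add: \<eta>_def)
  have "bracket (\<tau> - \<beta> * \<xi> ^ 3) powr p \<le> bracket (\<tau> - \<beta> * \<xi> ^ 3) powr \<bar>p\<bar>"
    by (intro powr_mono bracket_ge_1) auto
  also have "\<dots> \<le> (bracket (A - \<beta> * B ^ 3) * (bracket \<sigma> * (bracket \<beta> * ((bracket B)\<^sup>2 * bracket \<eta> ^ 3)))) powr \<bar>p\<bar>"
    using bracket_modulation_le[of A \<sigma> \<beta> B \<eta>] by (intro powr_mono2) (auto simp: \<sigma>_def \<eta>_def)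
  also have "\<dots> = (bracket (A - \<beta> * B ^ 3) * (bracket B)\<^sup>2) powr \<bar>p\<bar>
      * (bracket \<beta> powr \<bar>p\<bar> * bracket \<sigma> powr \<bar>p\<bar> * bracket \<eta> powr (3 * \<bar>p\<bar>))"
    by (simp add: powr_mult powr_powr[symmetric] powr_numeral)
  finally have "bracket \<xi> powr s * bracket (\<tau> - \<beta> * \<xi> ^ 3) powr p
      \<le> (bracket B powr s * bracket \<eta> powr \<bar>s\<bar>) * ((bracket (A - \<beta> * B ^ 3) * (bracket B)\<^sup>2) powr \<bar>p\<bar>
      * (bracket \<beta> powr \<bar>p\<bar> * bracket \<sigma> powr \<bar>p\<bar> * bracket \<eta> powr (3 * \<bar>p\<bar>)))"
    by (intro mult_mono s) auto
  also have "\<dots> = W * bracket \<beta> powr \<bar>p\<bar> * (bracket \<sigma> powr \<bar>p\<bar> * bracket \<eta> powr q)"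
    by (simp add: W_def q_def powr_add mult_ac)
  finally have "bracket \<xi> powr s * bracket (\<tau> - \<beta> * \<xi> ^ 3) powr p * exp (- c * (\<sigma>\<^sup>2 + \<eta>\<^sup>2))
      \<le> W * bracket \<beta> powr \<bar>p\<bar> * (bracket \<sigma> powr \<bar>p\<bar> * bracket \<eta> powr q) * exp (- c * (\<sigma>\<^sup>2 + \<eta>\<^sup>2))"
    by (intro mult_right_mono) auto
  also have "\<dots> = W * bracket \<beta> powr \<bar>p\<bar>
      * ((bracket \<sigma> powr \<bar>p\<bar> * exp (- c * \<sigma>\<^sup>2)) * (bracket \<eta> powr q * exp (- c * \<eta>\<^sup>2)))"
    by (simp add: distrib_left exp_diff exp_minus field_simps)
  also have "\<dots> \<le> W * bracket \<beta> powr \<bar>p\<bar>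
      * ((exp (\<bar>p\<bar>\<^sup>2 / (2 * c)) * exp (- (c / 2) * \<sigma>\<^sup>2)) * (exp (q\<^sup>2 / (2 * c)) * exp (- (c / 2) * \<eta>\<^sup>2)))"
    using assms W by (intro mult_left_mono mult_mono bracket_powr_gaussian_le) auto
  also have "\<dots> = K * W * exp (- (c / 2) * (\<sigma>\<^sup>2 + \<eta>\<^sup>2))"
    unfolding K_def distrib_left exp_add by (simp only: mult_ac)
  finally show "bracket \<xi> powr s * bracket (\<tau> - \<beta> * \<xi> ^ 3) powr p * exp (- c * ((\<tau> - A)\<^sup>2 + (\<xi> - B)\<^sup>2))
      \<le> K * (bracket B powr s * (bracket (A - \<beta> * B ^ 3) * (bracket B)\<^sup>2) powr \<bar>p\<bar>)
          * exp (- (c / 2) * ((\<tau> - A)\<^sup>2 + (\<xi> - B)\<^sup>2))"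
    unfolding W_def \<sigma>_def \<eta>_def .
qed

text \<open>
  Two-sided bounds on \<open>y\<close> are used because the exponents \<open>s\<close> and \<open>b'\<close> may have either sign: the bound
  that counts for \<open>p \<ge> 0\<close> is the lower one, for \<open>p < 0\<close> the upper one.
\<close>

lemma min_powr_le_powr:
  fixes x y :: real
  assumes "0 < a" "0 < x" "a * x \<le> y" "y \<le> d * x"
  shows "min (a powr p) (d powr p) * x powr p \<le> y powr p"
proof -
  have "0 < y" using assms by (meson mult_pos_pos order_less_le_trans)
  have "0 < d" using assms \<open>0 < y\<close> by (metis order_less_le_trans zero_less_mult_pos2)
  show ?thesis
  proof (cases "p \<ge> 0")
    case True
    then have "(a * x) powr p \<le> y powr p" using assms by (intro powr_mono2) auto
    moreover have "min (a powr p) (d powr p) * x powr p \<le> a powr p * x powr p"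
      by (intro mult_right_mono) auto
    ultimately show ?thesis using assms by (simp only: powr_mult)
  next
    case False
    then have "(d * x) powr p \<le> y powr p" using assms \<open>0 < y\<close> by (intro powr_mono2') auto
    moreover have "min (a powr p) (d powr p) * x powr p \<le> d powr p * x powr p"
      by (intro mult_right_mono) auto
    ultimately show ?thesis using assms \<open>0 < d\<close> by (simp only: powr_mult)
  qed
qed

section \<open>Norms of wave packets\<close>

lemma L2_norm_gaussian_le:
  assumes "c > 0" "M \<ge> 0"
    and le: "\<And>\<tau> \<xi>. cmod (g (\<tau>, \<xi>)) \<le> M * exp (- c * ((\<tau> - A)\<^sup>2 + (\<xi> - B)\<^sup>2))"
  shows "L2_norm g \<le> M * (LINT x|lborel. exp (- (2 * c) * x\<^sup>2))"
proof -
  let ?G = "\<lambda>(\<tau>, \<xi>). exp (- (2 * c) * ((\<tau> - A)\<^sup>2 + (\<xi> - B)\<^sup>2))"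
  have int: "integrable lborel (\<lambda>p. M\<^sup>2 * ?G p)"
    using assms by (intro integrable_mult_right integrable_gaussian_plane) auto
  have "(cmod (g p))\<^sup>2 \<le> M\<^sup>2 * ?G p" for p
  proof (cases p)
    case (Pair \<tau> \<xi>)
    have "(cmod (g (\<tau>, \<xi>)))\<^sup>2 \<le> (M * exp (- c * ((\<tau> - A)\<^sup>2 + (\<xi> - B)\<^sup>2)))\<^sup>2"
      by (intro power_mono le) auto
    also have "\<dots> = M\<^sup>2 * exp (- (2 * c) * ((\<tau> - A)\<^sup>2 + (\<xi> - B)\<^sup>2))"
      by (simp add: power_mult_distrib exp_double[symmetric] mult.assoc)
    finally show ?thesis by (simp add: Pair)
  qed
  then have "(LINT p|lborel. (cmod (g p))\<^sup>2) \<le> (LINT p|lborel. M\<^sup>2 * ?G p)"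
    by (intro integral_mono'[OF int]) auto
  also have "\<dots> = M\<^sup>2 * (LINT x|lborel. exp (- (2 * c) * x\<^sup>2))\<^sup>2"
    using assms by (subst integral_mult_right_zero, subst integral_gaussian_plane) auto
  finally have "L2_norm g \<le> sqrt ((M * (LINT x|lborel. exp (- (2 * c) * x\<^sup>2)))\<^sup>2)"
    unfolding L2_norm_def power_mult_distrib by (rule real_sqrt_le_mono)
  then show ?thesis using assms by (simp add: integral_nonneg_AE)
qed

text \<open>
  Integrability has to be assumed: the integral of a function that is not integrable is zero by
  convention, so \<open>L2_norm g\<close> would be zero however large \<open>g\<close> is on the square.
\<close>

lemma L2_norm_ge_on_unit_square:
  assumes int: "integrable lborel (\<lambda>p. (cmod (g p))\<^sup>2)" and "m \<ge> 0"
    and ge: "\<And>\<tau> \<xi>. A \<le> \<tau> \<Longrightarrow> \<tau> \<le> A + 1 \<Longrightarrow> B \<le> \<xi> \<Longrightarrow> \<xi> \<le> B + 1 \<Longrightarrow> m \<le> cmod (g (\<tau>, \<xi>))"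
  shows "m \<le> L2_norm g"
proof -
  let ?Q = "cbox (A, B) (A + 1, B + 1)"
  have "measure lborel ?Q = 1" by (simp add: content_Pair)
  then have "m\<^sup>2 = (LINT p|lborel. m\<^sup>2 * indicator ?Q p)" by simp
  also have "\<dots> \<le> (LINT p|lborel. (cmod (g p))\<^sup>2)"
  proof (rule integral_mono')
    fix p :: "real \<times> real"
    show "m\<^sup>2 * indicator ?Q p \<le> (cmod (g p))\<^sup>2"
      using ge assms(2) by (cases p) (auto simp: indicator_def cbox_Pair_eq intro!: power_mono)
  qed (use int in auto)
  finally show ?thesis unfolding L2_norm_def using assms(2) by (intro real_le_rsqrt)
qed

lemma X_norm_nonneg: "0 \<le> X_norm \<alpha> s b f"
  by (simp add: X_norm_def L2_norm_def)

text \<open>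
  The centre of the packet lies on the curve \<open>\<tau> = \<gamma> \<xi>\<^sup>3\<close>, so the modulation weight is due only to the
  unit width of the packet, across which the modulation reaches \<open>\<langle>N\<rangle>\<^sup>2\<close>.
\<close>

lemma X_norm_packet_on_curve_le:
  assumes "b \<ge> 0"
  obtains K where "K \<ge> 0"
    "\<And>N. X_norm \<gamma> k b (packet 1 (\<gamma> * N ^ 3) N) \<le> K * bracket N powr (k + 2 * b)"
proof -
  obtain K where K: "K \<ge> 0" and le: "\<And>A B \<tau> \<xi>.
    bracket \<xi> powr k * bracket (\<tau> - \<gamma> * \<xi> ^ 3) powr b * exp (- (1 / 2) * ((\<tau> - A)\<^sup>2 + (\<xi> - B)\<^sup>2))
      \<le> K * (bracket B powr k * (bracket (A - \<gamma> * B ^ 3) * (bracket B)\<^sup>2) powr \<bar>b\<bar>)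
          * exp (- (1 / 2 / 2) * ((\<tau> - A)\<^sup>2 + (\<xi> - B)\<^sup>2))"
    using weight_gaussian_le[of "1 / 2" k \<gamma> b] by (metis half_gt_zero_iff zero_less_one)
  define I where "I = (LINT x|lborel. exp (- (2 * (1 / 2 / 2)) * x\<^sup>2) :: real)"
  have I: "I \<ge> 0" by (simp add: I_def integral_nonneg_AE)
  have "X_norm \<gamma> k b (packet 1 (\<gamma> * N ^ 3) N) \<le> (2 * pi * K * bracket N powr (k + 2 * b)) * I" for N
    unfolding X_norm_def I_def
  proof (rule L2_norm_gaussian_le)
    show "0 \<le> 2 * pi * K * bracket N powr (k + 2 * b)" using K by simp
    fix \<tau> \<xi> :: real
    let ?E = "(\<tau> - \<gamma> * N ^ 3)\<^sup>2 + (\<xi> - N)\<^sup>2"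
    have "bracket N powr k * (bracket (\<gamma> * N ^ 3 - \<gamma> * N ^ 3) * (bracket N)\<^sup>2) powr \<bar>b\<bar>
        = bracket N powr (k + 2 * b)"
      using assms by (simp add: bracket_def[of 0] powr_add powr_powr[symmetric] powr_numeral)
    then have "bracket \<xi> powr k * bracket (\<tau> - \<gamma> * \<xi> ^ 3) powr b * exp (- (1 / 2) * ?E)
        \<le> K * bracket N powr (k + 2 * b) * exp (- (1 / 2 / 2) * ?E)"
      using le[of \<xi> \<tau> "\<gamma> * N ^ 3" N] by simp
    then have "2 * pi * (bracket \<xi> powr k * bracket (\<tau> - \<gamma> * \<xi> ^ 3) powr b * exp (- (1 / 2) * ?E))
        \<le> 2 * pi * (K * bracket N powr (k + 2 * b) * exp (- (1 / 2 / 2) * ?E))"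
      by (intro mult_left_mono) auto
    moreover have "cmod (case (\<tau>, \<xi>) of (\<tau>, \<xi>) \<Rightarrow> (bracket \<xi> powr k * bracket (\<tau> - \<gamma> * \<xi> ^ 3) powr b) *\<^sub>R
          fourier (packet 1 (\<gamma> * N ^ 3) N) (\<tau>, \<xi>))
        = 2 * pi * (bracket \<xi> powr k * bracket (\<tau> - \<gamma> * \<xi> ^ 3) powr b * exp (- (1 / 2) * ?E))"
      unfolding split norm_scaleR fourier_packet[OF zero_less_one] norm_of_real
      by (simp add: abs_mult)
    ultimately show "cmod (case (\<tau>, \<xi>) of (\<tau>, \<xi>) \<Rightarrow> (bracket \<xi> powr k * bracket (\<tau> - \<gamma> * \<xi> ^ 3) powr b) *\<^sub>R
          fourier (packet 1 (\<gamma> * N ^ 3) N) (\<tau>, \<xi>))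
        \<le> 2 * pi * K * bracket N powr (k + 2 * b) * exp (- (1 / 2 / 2) * ?E)"
      by (simp only: mult.assoc)
  qed simp
  then show ?thesis using K I that[of "2 * pi * K * I"] by (simp add: mult_ac)
qed


text \<open>
  The centre \<open>(\<gamma> N\<^sup>3, N)\<close> of the packet lies at height \<open>(\<gamma> - \<beta>) N\<^sup>3\<close> over the curve \<open>\<tau> = \<beta> \<xi>\<^sup>3\<close>.
  On a unit square next to the centre the modulation varies by \<open>O(N\<^sup>2)\<close>, hence stays comparable to \<open>N\<^sup>3\<close>
  for large \<open>N\<close>, while \<open>\<xi>\<close> is comparable to \<open>N\<close> and the Gaussian is bounded below.
\<close>

lemma X_norm_dx_packet_off_curve_ge:
  assumes "\<beta> \<noteq> \<gamma>"
  obtains c N0 where "c > 0"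
    "\<And>N. N \<ge> N0 \<Longrightarrow> c * bracket N powr (s + 1 + 3 * p) \<le> X_norm \<beta> s p (dx (packet 3 (\<gamma> * N ^ 3) N))"
proof
  define a where "a = \<bar>\<gamma> - \<beta>\<bar> / 16"
  define d where "d = 2 + \<bar>\<gamma> - \<beta>\<bar> + 7 * \<bar>\<beta>\<bar>"
  define c where "c = min (1 powr s) (2 powr s) * min (a powr p) (d powr p) * (1 / 2) * (2 * pi / 3 * exp (- 1 / 3))"
  have a: "a > 0" using assms by (simp add: a_def)
  have d: "d > 0" by (simp add: d_def add_pos_nonneg)
  show c: "c > 0" using a d by (simp add: c_def)
  \<comment> \<open>From here on \<open>7 \<bar>\<beta>\<bar> N\<^sup>2\<close>, the variation of the modulation, is at most half of \<open>\<bar>\<gamma> - \<beta>\<bar> N\<^sup>3\<close>.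
    The constant \<open>a\<close> combines this half with \<open>\<langle>N\<rangle>\<^sup>3 \<le> 8 N\<^sup>3\<close>.\<close>
  fix N :: real
  assume N0: "N \<ge> max 1 (14 * \<bar>\<beta>\<bar> / \<bar>\<gamma> - \<beta>\<bar>)"
  then have N: "N \<ge> 1" by simp
  let ?A = "\<gamma> * N ^ 3"
  let ?E = "\<lambda>\<tau> \<xi>. (\<tau> - ?A)\<^sup>2 + (\<xi> - N)\<^sup>2"
  define g where "g = (\<lambda>(\<tau>, \<xi>). (bracket \<xi> powr s * bracket (\<tau> - \<beta> * \<xi> ^ 3) powr p) *\<^sub>R
          fourier (dx (packet 3 ?A N)) (\<tau>, \<xi>))"
  have cmod_g: "cmod (g (\<tau>, \<xi>)) = bracket \<xi> powr s * bracket (\<tau> - \<beta> * \<xi> ^ 3) powr p * \<bar>\<xi>\<bar>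
      * (2 * pi / 3 * exp (- (1 / 6) * ?E \<tau> \<xi>))" for \<tau> \<xi>
    by (simp add: g_def fourier_dx_packet fourier_packet norm_mult abs_mult)
  have "c * bracket N powr (s + 1 + 3 * p) \<le> L2_norm g"
  proof (rule L2_norm_ge_on_unit_square)
    show "c * bracket N powr (s + 1 + 3 * p) \<ge> 0" using c by simp
  next
    \<comment> \<open>The factor \<open>\<xi>\<close> of the derivative is absorbed into the weight \<open>\<langle>\<xi>\<rangle>\<close> to the power \<open>s + 1\<close>.\<close>
    obtain K where K: "K \<ge> 0" and le: "\<And>A B \<tau> \<xi>.
      bracket \<xi> powr (s + 1) * bracket (\<tau> - \<beta> * \<xi> ^ 3) powr p * exp (- (1 / 6) * ((\<tau> - A)\<^sup>2 + (\<xi> - B)\<^sup>2))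
        \<le> K * (bracket B powr (s + 1) * (bracket (A - \<beta> * B ^ 3) * (bracket B)\<^sup>2) powr \<bar>p\<bar>)
            * exp (- (1 / 6 / 2) * ((\<tau> - A)\<^sup>2 + (\<xi> - B)\<^sup>2))"
      using weight_gaussian_le[of "1 / 6" "s + 1" \<beta> p] by (metis zero_less_divide_1_iff zero_less_numeral)
    define M where "M = 2 * pi / 3 * (K * (bracket N powr (s + 1) * (bracket (?A - \<beta> * N ^ 3) * (bracket N)\<^sup>2) powr \<bar>p\<bar>))"
    have "(cmod (g (\<tau>, \<xi>)))\<^sup>2 \<le> M\<^sup>2 * exp (- (1 / 6) * ?E \<tau> \<xi>)" for \<tau> \<xi>
    proof -
      have "bracket \<xi> powr s * \<bar>\<xi>\<bar> \<le> bracket \<xi> powr s * bracket \<xi>"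
        by (intro mult_left_mono) (auto simp: bracket_def)
      also have "\<dots> = bracket \<xi> powr (s + 1)"
        by (simp add: powr_add)
      finally have "(bracket \<xi> powr s * \<bar>\<xi>\<bar>) * (bracket (\<tau> - \<beta> * \<xi> ^ 3) powr p * exp (- (1 / 6) * ?E \<tau> \<xi>))
          \<le> bracket \<xi> powr (s + 1) * (bracket (\<tau> - \<beta> * \<xi> ^ 3) powr p * exp (- (1 / 6) * ?E \<tau> \<xi>))"
        by (intro mult_right_mono) auto
      also have "\<dots> \<le> K * (bracket N powr (s + 1) * (bracket (?A - \<beta> * N ^ 3) * (bracket N)\<^sup>2) powr \<bar>p\<bar>)
            * exp (- (1 / 6 / 2) * ?E \<tau> \<xi>)"
        using le[of \<xi> \<tau> ?A N] by (simp only: mult.assoc)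
      finally have "2 * pi / 3 * ((bracket \<xi> powr s * \<bar>\<xi>\<bar>) * (bracket (\<tau> - \<beta> * \<xi> ^ 3) powr p * exp (- (1 / 6) * ?E \<tau> \<xi>)))
          \<le> 2 * pi / 3 * (K * (bracket N powr (s + 1) * (bracket (?A - \<beta> * N ^ 3) * (bracket N)\<^sup>2) powr \<bar>p\<bar>)
            * exp (- (1 / 6 / 2) * ?E \<tau> \<xi>))"
        by (intro mult_left_mono) auto
      then have "cmod (g (\<tau>, \<xi>)) \<le> M * exp (- (1 / 12) * ?E \<tau> \<xi>)"
        unfolding cmod_g M_def by (simp add: mult_ac)
      then have "(cmod (g (\<tau>, \<xi>)))\<^sup>2 \<le> (M * exp (- (1 / 12) * ?E \<tau> \<xi>))\<^sup>2"
        by (intro power_mono) auto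
      also have "\<dots> = M\<^sup>2 * exp (- (1 / 6) * ?E \<tau> \<xi>)"
        by (simp add: power_mult_distrib exp_double[symmetric])
      finally show ?thesis .
    qed
    note le' = this
    show "integrable lborel (\<lambda>p. (cmod (g p))\<^sup>2)"
    proof (rule Bochner_Integration.integrable_bound)
      show "integrable lborel (\<lambda>p. M\<^sup>2 * (case p of (\<tau>, \<xi>) \<Rightarrow> exp (- (1 / 6) * ?E \<tau> \<xi>)))"
        by (intro integrable_mult_right integrable_gaussian_plane) auto
      have "continuous_on UNIV (\<lambda>z. (bracket (snd z) powr s * bracket (fst z - \<beta> * snd z ^ 3) powr p * \<bar>snd z\<bar>
          * (2 * pi / 3 * exp (- (1 / 6) * ?E (fst z) (snd z))))\<^sup>2)"
        unfolding bracket_def by (intro continuous_intros) (auto simp: add_nonneg_eq_0_iff)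
      also have "(\<lambda>z. (bracket (snd z) powr s * bracket (fst z - \<beta> * snd z ^ 3) powr p * \<bar>snd z\<bar>
          * (2 * pi / 3 * exp (- (1 / 6) * ?E (fst z) (snd z))))\<^sup>2) = (\<lambda>z. (cmod (g z))\<^sup>2)"
        using cmod_g by (auto simp: fun_eq_iff)
      finally show "(\<lambda>p. (cmod (g p))\<^sup>2) \<in> borel_measurable lborel"
        by (simp add: borel_measurable_continuous_onI)
      show "AE z in lborel. norm ((cmod (g z))\<^sup>2) \<le> norm (M\<^sup>2 * (case z of (\<tau>, \<xi>) \<Rightarrow> exp (- (1 / 6) * ?E \<tau> \<xi>)))"
        using le' by (intro AE_I2) (auto simp: abs_mult split: prod.split)
    qed
  next
    fix \<tau> \<xi> :: real
    assume \<tau>: "?A \<le> \<tau>" "\<tau> \<le> ?A + 1" and \<xi>: "N \<le> \<xi>" "\<xi> \<le> N + 1"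
    define \<sigma> where "\<sigma> = \<tau> - ?A"
    define \<eta> where "\<eta> = \<xi> - N"
    have \<sigma>: "0 \<le> \<sigma>" "\<sigma> \<le> 1" using \<tau> by (auto simp: \<sigma>_def)
    have \<eta>: "0 \<le> \<eta>" "\<eta> \<le> 1" using \<xi> by (auto simp: \<eta>_def)
    let ?m = "3 * N\<^sup>2 * \<eta> + 3 * N * \<eta>\<^sup>2 + \<eta> ^ 3"
    have m: "0 \<le> ?m" "?m \<le> 7 * N\<^sup>2"
    proof -
      show "0 \<le> ?m" using N \<eta> by simp
      have "1 \<le> N\<^sup>2" using N by simp
      moreover have "N \<le> N\<^sup>2" using N by (simp add: power2_eq_square mult_le_cancel_left1)
      moreover have "N\<^sup>2 * \<eta> \<le> N\<^sup>2" using \<eta> by (simp add: mult_left_le)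
      moreover have "N * \<eta>\<^sup>2 \<le> N" using N \<eta> by (simp add: mult_left_le power_le_one)
      moreover have "\<eta> ^ 3 \<le> 1" using \<eta> by (simp add: power_le_one)
      ultimately show "?m \<le> 7 * N\<^sup>2" by linarith
    qed
    have \<beta>m: "\<bar>\<beta> * ?m\<bar> \<le> 7 * \<bar>\<beta>\<bar> * N\<^sup>2"
      using mult_left_mono[OF m(2), of "\<bar>\<beta>\<bar>"] m(1) by (simp add: abs_mult mult_ac)
    have modulation: "\<tau> - \<beta> * \<xi> ^ 3 = (\<gamma> - \<beta>) * N ^ 3 + (\<sigma> - \<beta> * ?m)"
      by (simp add: \<sigma>_def \<eta>_def power2_eq_square power3_eq_cube algebra_simps)
    have abs_cube: "\<bar>(\<gamma> - \<beta>) * N ^ 3\<bar> = \<bar>\<gamma> - \<beta>\<bar> * N ^ 3"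
      using N by (simp add: abs_mult)
    have "a * bracket N ^ 3 \<le> bracket (\<tau> - \<beta> * \<xi> ^ 3)"
    proof -
      have "bracket N ^ 3 \<le> (2 * N) ^ 3"
        using N by (intro power_mono) (auto simp: bracket_def)
      then have "a * bracket N ^ 3 \<le> a * (2 * N) ^ 3"
        using a by (intro mult_left_mono) auto
      also have "\<dots> = \<bar>\<gamma> - \<beta>\<bar> * N ^ 3 - \<bar>\<gamma> - \<beta>\<bar> * N ^ 3 / 2"
        by (simp add: a_def power_mult_distrib)
      also have "\<dots> \<le> \<bar>\<gamma> - \<beta>\<bar> * N ^ 3 - 7 * \<bar>\<beta>\<bar> * N\<^sup>2"
      proof -
        have "14 * \<bar>\<beta>\<bar> \<le> \<bar>\<gamma> - \<beta>\<bar> * N"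
          using N0 assms by (simp add: field_simps)
        then have "14 * \<bar>\<beta>\<bar> * N\<^sup>2 \<le> \<bar>\<gamma> - \<beta>\<bar> * N * N\<^sup>2"
          by (intro mult_right_mono) auto
        then show ?thesis by (simp add: power2_eq_square power3_eq_cube mult_ac)
      qed
      also have "\<dots> \<le> bracket (\<tau> - \<beta> * \<xi> ^ 3)"
        unfolding modulation bracket_def using abs_cube \<beta>m \<sigma> by linarith
      finally show ?thesis .
    qed
    moreover have "bracket (\<tau> - \<beta> * \<xi> ^ 3) \<le> d * bracket N ^ 3"
    proof -
      have "bracket (\<tau> - \<beta> * \<xi> ^ 3) \<le> 2 + \<bar>\<gamma> - \<beta>\<bar> * N ^ 3 + 7 * \<bar>\<beta>\<bar> * N\<^sup>2"
        unfolding modulation bracket_def using abs_cube \<beta>m \<sigma> by linarith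
      also have "\<dots> \<le> 2 * bracket N ^ 3 + \<bar>\<gamma> - \<beta>\<bar> * bracket N ^ 3 + 7 * \<bar>\<beta>\<bar> * bracket N ^ 3"
      proof (intro add_mono mult_left_mono)
        show "2 \<le> 2 * bracket N ^ 3" using one_le_power[OF bracket_ge_1, of N 3] by simp
        show "N ^ 3 \<le> bracket N ^ 3" using N by (intro power_mono) (auto simp: bracket_def)
        have "N\<^sup>2 \<le> bracket N ^ 2" using N by (intro power_mono) (auto simp: bracket_def)
        also have "\<dots> \<le> bracket N ^ 3" by (intro power_increasing bracket_ge_1) simp
        finally show "N\<^sup>2 \<le> bracket N ^ 3" .
      qed auto
      also have "\<dots> = d * bracket N ^ 3" by (simp add: d_def algebra_simps)
      finally show ?thesis .
    qed
    ultimately have w1: "min (a powr p) (d powr p) * (bracket N ^ 3) powr p \<le> bracket (\<tau> - \<beta> * \<xi> ^ 3) powr p"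
      using a by (intro min_powr_le_powr) auto
    have w2: "min (1 powr s) (2 powr s) * bracket N powr s \<le> bracket \<xi> powr s"
      using N \<xi> by (intro min_powr_le_powr) (auto simp: bracket_def)
    have w3: "1 / 2 * bracket N \<le> \<bar>\<xi>\<bar>"
      using N \<xi> by (simp add: bracket_def)
    have w4: "2 * pi / 3 * exp (- 1 / 3) \<le> 2 * pi / 3 * exp (- (1 / 6) * ?E \<tau> \<xi>)"
    proof -
      have "\<sigma>\<^sup>2 \<le> 1" "\<eta>\<^sup>2 \<le> 1" using \<sigma> \<eta> by (auto intro: power_le_one)
      then have "- 1 / 3 \<le> - (1 / 6) * ?E \<tau> \<xi>" by (simp add: \<sigma>_def \<eta>_def)
      then show ?thesis by (intro mult_left_mono) auto
    qed
    have "(min (1 powr s) (2 powr s) * bracket N powr s) * (min (a powr p) (d powr p) * (bracket N ^ 3) powr p)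
        * (1 / 2 * bracket N) * (2 * pi / 3 * exp (- 1 / 3)) \<le> cmod (g (\<tau>, \<xi>))"
      unfolding cmod_g using a d by (intro mult_mono w1 w2 w3 w4) (auto intro!: mult_nonneg_nonneg)
    moreover have "bracket N powr (s + 1 + 3 * p) = bracket N powr s * (bracket N ^ 3) powr p * bracket N"
      by (simp add: powr_add powr_powr[symmetric] powr_numeral)
    ultimately show "c * bracket N powr (s + 1 + 3 * p) \<le> cmod (g (\<tau>, \<xi>))"
      unfolding c_def by (simp only: mult_ac)
  qed
  then show "c * bracket N powr (s + 1 + 3 * p) \<le> X_norm \<beta> s p (dx (packet 3 ?A N))"
    unfolding X_norm_def g_def .
qed

section \<open>Failure of the trilinear estimates\<close>

text \<open>
  The output packet has width parameter \<open>3\<close> because it is a product of three packets of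
  width parameter \<open>1\<close>. Only the modulated factor depends on \<open>N\<close>, so the norms of the other two merge into
  the constant.
\<close>

lemma trilinear_estimate_fails:
  assumes "\<beta> \<noteq> \<gamma>" "b \<ge> 0" "k + 2 * b < s + 1 + 3 * b'"
  obtains v w w' where "schwartz v" "schwartz w" "schwartz w'"
    "C * (X_norm \<beta> s b v * X_norm \<gamma> k b w * X_norm \<gamma> k b w')
       < X_norm \<beta> s b' (dx (\<lambda>z. v z * w z * w' z))"
proof -
  define \<delta> where "\<delta> = (s + 1 + 3 * b') - (k + 2 * b)"
  have \<delta>: "\<delta> > 0" using assms(3) by (simp add: \<delta>_def)
  let ?G = "packet 1 0 0"
  obtain K where K: "K \<ge> 0"
    "\<And>N. X_norm \<gamma> k b (packet 1 (\<gamma> * N ^ 3) N) \<le> K * bracket N powr (k + 2 * b)"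
    using X_norm_packet_on_curve_le[OF assms(2)] by blast
  obtain c N0 where c: "c > 0" "\<And>N. N \<ge> N0 \<Longrightarrow>
      c * bracket N powr (s + 1 + 3 * b') \<le> X_norm \<beta> s b' (dx (packet 3 (\<gamma> * N ^ 3) N))"
    using X_norm_dx_packet_off_curve_ge[OF assms(1)] by blast
  define V where "V = \<bar>C\<bar> * (X_norm \<beta> s b ?G * X_norm \<gamma> k b ?G)"
  have V: "V \<ge> 0" by (simp add: V_def X_norm_nonneg)
  have "filterlim (\<lambda>N. bracket N powr \<delta>) at_top at_top"
    unfolding bracket_def using \<delta> by real_asymp
  then have "eventually (\<lambda>N. bracket N powr \<delta> > V * K / c) at_top"
    by (simp add: filterlim_at_top_dense)
  then have "eventually (\<lambda>N. bracket N powr \<delta> > V * K / c \<and> N \<ge> N0) at_top"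
    using eventually_ge_at_top by (rule eventually_conj)
  then obtain N where N: "bracket N powr \<delta> > V * K / c" "N \<ge> N0"
    using eventually_happens by force
  let ?w = "packet 1 (\<gamma> * N ^ 3) N"
  have "C * (X_norm \<beta> s b ?G * X_norm \<gamma> k b ?w * X_norm \<gamma> k b ?G)
      \<le> \<bar>C\<bar> * (X_norm \<beta> s b ?G * X_norm \<gamma> k b ?w * X_norm \<gamma> k b ?G)"
    by (intro mult_right_mono) (auto simp: X_norm_nonneg)
  also have "\<dots> = V * X_norm \<gamma> k b ?w"
    by (simp add: V_def)
  also have "\<dots> \<le> V * (K * bracket N powr (k + 2 * b))"
    by (intro mult_left_mono K V)
  also have "\<dots> = (V * K) * bracket N powr (k + 2 * b)"
    by simp
  also have "\<dots> < (c * bracket N powr \<delta>) * bracket N powr (k + 2 * b)"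
    using N(1) c(1) by (intro mult_strict_right_mono) (auto simp: field_simps)
  also have "\<dots> = c * bracket N powr (s + 1 + 3 * b')"
    by (simp add: \<delta>_def powr_add[symmetric])
  also have "\<dots> \<le> X_norm \<beta> s b' (dx (packet 3 (\<gamma> * N ^ 3) N))"
    by (rule c(2)[OF N(2)])
  also have "packet 3 (\<gamma> * N ^ 3) N = (\<lambda>z. ?G z * ?w z * ?G z)"
    by (simp add: packet_mult)
  finally show ?thesis
    using that[of ?G ?w ?G] schwartz_packet by simp
qed

theorem proposition1p7:
  fixes \<alpha> :: real
  assumes "\<alpha> \<noteq> 0" and "\<alpha> \<noteq> 1"
  shows
    "(\<forall>s k \<epsilon> b b' :: real.
        s - k > 2 \<and> 0 < \<epsilon> \<and> \<epsilon> < 2 / 3 * (s - k - 2) \<and> b = 1 / 2 + \<epsilon> \<and> b' = - 1 / 2 + 2 * \<epsilon> \<longrightarrow>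
        \<not> (\<exists>C>0. \<forall>v w1 w2. schwartz v \<and> schwartz w1 \<and> schwartz w2 \<longrightarrow>
              X_norm 1 s b' (dx (\<lambda>z. v z * w1 z * w2 z))
                \<le> C * (X_norm 1 s b v * X_norm \<alpha> k b w1 * X_norm \<alpha> k b w2)))
     \<and>
     (\<forall>s k \<epsilon> b b' :: real.
        k - s > 2 \<and> 0 < \<epsilon> \<and> \<epsilon> < 2 / 3 * (k - s - 2) \<and> b = 1 / 2 + \<epsilon> \<and> b' = - 1 / 2 + 2 * \<epsilon> \<longrightarrow>
        \<not> (\<exists>C>0. \<forall>v1 v2 w. schwartz v1 \<and> schwartz v2 \<and> schwartz w \<longrightarrow>
              X_norm \<alpha> k b' (dx (\<lambda>z. v1 z * v2 z * w z))
                \<le> C * (X_norm 1 s b v1 * X_norm 1 s b v2 * X_norm \<alpha> k b w)))"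
proof (intro conjI allI impI notI)
  fix s k \<epsilon> b b' :: real
  assume h: "s - k > 2 \<and> 0 < \<epsilon> \<and> \<epsilon> < 2 / 3 * (s - k - 2) \<and> b = 1 / 2 + \<epsilon> \<and> b' = - 1 / 2 + 2 * \<epsilon>"
  assume "\<exists>C>0. \<forall>v w1 w2. schwartz v \<and> schwartz w1 \<and> schwartz w2 \<longrightarrow>
              X_norm 1 s b' (dx (\<lambda>z. v z * w1 z * w2 z))
                \<le> C * (X_norm 1 s b v * X_norm \<alpha> k b w1 * X_norm \<alpha> k b w2)"
  then obtain C where C: "\<And>v w1 w2. schwartz v \<and> schwartz w1 \<and> schwartz w2 \<Longrightarrow>
              X_norm 1 s b' (dx (\<lambda>z. v z * w1 z * w2 z))
                \<le> C * (X_norm 1 s b v * X_norm \<alpha> k b w1 * X_norm \<alpha> k b w2)"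
    by blast
  have "1 \<noteq> \<alpha>" "b \<ge> 0" "k + 2 * b < s + 1 + 3 * b'" using h assms by auto
  then show False
    by (rule trilinear_estimate_fails[of 1 \<alpha> b k s b' C]) (use C in \<open>force simp: not_le[symmetric]\<close>)
next
  fix s k \<epsilon> b b' :: real
  assume h: "k - s > 2 \<and> 0 < \<epsilon> \<and> \<epsilon> < 2 / 3 * (k - s - 2) \<and> b = 1 / 2 + \<epsilon> \<and> b' = - 1 / 2 + 2 * \<epsilon>"
  assume "\<exists>C>0. \<forall>v1 v2 w. schwartz v1 \<and> schwartz v2 \<and> schwartz w \<longrightarrow>
              X_norm \<alpha> k b' (dx (\<lambda>z. v1 z * v2 z * w z))
                \<le> C * (X_norm 1 s b v1 * X_norm 1 s b v2 * X_norm \<alpha> k b w)"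
  then obtain C where C: "\<And>v1 v2 w. schwartz v1 \<and> schwartz v2 \<and> schwartz w \<Longrightarrow>
              X_norm \<alpha> k b' (dx (\<lambda>z. v1 z * v2 z * w z))
                \<le> C * (X_norm 1 s b v1 * X_norm 1 s b v2 * X_norm \<alpha> k b w)"
    by blast
  have "b \<ge> 0" "s + 2 * b < k + 1 + 3 * b'" using h by auto
  then obtain w v1 v2 where f: "schwartz w" "schwartz v1" "schwartz v2"
    "C * (X_norm \<alpha> k b w * X_norm 1 s b v1 * X_norm 1 s b v2)
       < X_norm \<alpha> k b' (dx (\<lambda>z. w z * v1 z * v2 z))"
    using trilinear_estimate_fails[OF assms(2)] by blast
  have "(\<lambda>z. w z * v1 z * v2 z) = (\<lambda>z. v1 z * v2 z * w z)" by (simp add: mult_ac)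
  then show False using C[of v1 v2 w] f by (simp add: mult_ac)
qed

end
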